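(* Let $G$ be a connected graph containing no induced $P_5$ and no induced gem, whose vertex set is partitioned into seven non-empty sets $A_1,\dots,A_7$ such that: $A_1,\dots,A_5$ are cliques; $G[A_6]$ is $P_4$-free; $A_1$ is complete to $A_2\cup A_5\cup A_6$ and anticomplete to $A_3\cup A_4\cup A_7$; $A_3$ is complete to $A_2\cup A_4\cup A_6$ and anticomplete to $A_5\cup A_7$; $A_4$ is complete to $A_5\cup A_6$ and anticomplete to $A_2\cup A_7$; $A_2$ is anticomplete to $A_5\cup A_6\cup A_7$; $A_5$ is anticomplete to $A_6\cup A_7$; and the vertex set of each connected component of $G[A_7]$ is a clique and is a homogeneous set of $G$ (the adjacency between $A_6$ and $A_7$ is otherwise unrestricted). Assume that every proper induced subgraph $G'$ of $G$ satisfies $\chi(G')\le \lceil\frac{5}{4}\omega(G')\rceil$. Then $\chi(G)\le \lceil\frac{5}{4}\omega(G)\rceil$.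
   Context: $P_k$ is the path on $k$ vertices; the gem is a $P_4$ plus a vertex adjacent to all four of its vertices. For vertex sets $X,Y$, $X$ is complete to $Y$ if every vertex of $X$ is adjacent to every vertex of $Y$, and anticomplete to $Y$ if there are no edges between $X$ and $Y$. A set $X\subseteq V(G)$ is homogeneous if every vertex outside $X$ with a neighbor in $X$ is adjacent to all of $X$. $G[X]$ is the subgraph induced by $X$. $\chi$ denotes the chromatic number and $\omega$ the clique number. *)

theory Defs
  imports Complex_Main "HOL-Library.Disjoint_Sets" "Graph_Theory.Graph_Theory"
begin

text \<open>
  A finite simple graph is a digraph satisfying the locale predicate \<^const>\<open>graph\<close>: finite, without
  loops or parallel arcs, and with a symmetric set of arcs. An edge between \<open>u\<close> and \<open>v\<close> is thus a pair
  of opposite arcs.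
\<close>

definition complete_to :: "('a, 'b) pre_digraph \<Rightarrow> 'a set \<Rightarrow> 'a set \<Rightarrow> bool" where
  "complete_to G X Y \<longleftrightarrow> (\<forall>x\<in>X. \<forall>y\<in>Y. x \<rightarrow>\<^bsub>G\<^esub> y)"

definition anticomplete_to :: "('a, 'b) pre_digraph \<Rightarrow> 'a set \<Rightarrow> 'a set \<Rightarrow> bool" where
  "anticomplete_to G X Y \<longleftrightarrow> (\<forall>x\<in>X. \<forall>y\<in>Y. \<not> x \<rightarrow>\<^bsub>G\<^esub> y)"

definition clique :: "('a, 'b) pre_digraph \<Rightarrow> 'a set \<Rightarrow> bool" where
  "clique G X \<longleftrightarrow> X \<subseteq> verts G \<and> (\<forall>x\<in>X. \<forall>y\<in>X. x \<noteq> y \<longrightarrow> x \<rightarrow>\<^bsub>G\<^esub> y)"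

definition homogeneous :: "('a, 'b) pre_digraph \<Rightarrow> 'a set \<Rightarrow> bool" where
  "homogeneous G X \<longleftrightarrow> X \<subseteq> verts G \<and>
     (\<forall>v\<in>verts G - X. (\<exists>x\<in>X. v \<rightarrow>\<^bsub>G\<^esub> x) \<longrightarrow> (\<forall>x\<in>X. v \<rightarrow>\<^bsub>G\<^esub> x))"

definition component :: "('a, 'b) pre_digraph \<Rightarrow> ('a, 'b) pre_digraph \<Rightarrow> bool" where
  "component G C \<longleftrightarrow> pre_digraph.max_subgraph G Digraph_Component.connected C"

definition contains_induced :: "('a, 'b) pre_digraph \<Rightarrow> ('c, 'd) pre_digraph \<Rightarrow> bool" where
  "contains_induced G H \<longleftrightarrow> (\<exists>H'. induced_subgraph H' G \<and> digraph_iso H H')"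

definition path_graph :: "nat \<Rightarrow> nat pair_pre_digraph" where
  "path_graph k = \<lparr> pverts = {..<k}, parcs = {(i, j). i < k \<and> j < k \<and> (j = Suc i \<or> i = Suc j)} \<rparr>"

definition gem :: "nat pair_pre_digraph" where
  "gem = \<lparr> pverts = insert 4 (pverts (path_graph 4)),
           parcs = parcs (path_graph 4) \<union> {4} \<times> pverts (path_graph 4) \<union> pverts (path_graph 4) \<times> {4} \<rparr>"

definition proper_colouring :: "('a, 'b) pre_digraph \<Rightarrow> nat \<Rightarrow> ('a \<Rightarrow> nat) \<Rightarrow> bool" where
  "proper_colouring G k c \<longleftrightarrow>
     c ` verts G \<subseteq> {..<k} \<and> (\<forall>u\<in>verts G. \<forall>v\<in>verts G. u \<rightarrow>\<^bsub>G\<^esub> v \<longrightarrow> c u \<noteq> c v)"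

definition chromatic_number :: "('a, 'b) pre_digraph \<Rightarrow> nat" where
  "chromatic_number G = (LEAST k. \<exists>c. proper_colouring G k c)"

definition clique_number :: "('a, 'b) pre_digraph \<Rightarrow> nat" where
  "clique_number G = Max {card X | X. clique G X}"

end

theory Submission
  imports Defs
begin

text \<open>
  Put \<open>k = \<lceil>5\<omega>/4\<rceil>\<close> and let \<open>M\<close> be the larger of the cliques \<open>A\<^sub>1\<close> and \<open>A\<^sub>3 \<union> A\<^sub>4\<close>. The proper induced
  subgraph on \<open>M \<union> A\<^sub>6 \<union> A\<^sub>7\<close> is \<open>k\<close>-colourable, and the set \<open>R\<close> of colours occurring on \<open>A\<^sub>6\<close> has at
  most \<open>k - |M|\<close> elements. Keep this colouring on \<open>A\<^sub>6 \<union> A\<^sub>7\<close>, use the colours of \<open>R\<close> as far as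
  possible on both \<open>A\<^sub>2\<close> and \<open>A\<^sub>5\<close>, and colour what remains of \<open>A\<^sub>1, \<dots>, A\<^sub>5\<close>, a blown-up 5-cycle,
  with the \<open>k - |R|\<close> other colours. This is possible because neither two consecutive cliques
  together exceed \<open>k - |R|\<close>, nor do all five together exceed \<open>2 (k - |R|)\<close>.
\<close>

section \<open>Colour sets of prescribed sizes\<close>

text \<open>Choose \<open>P\<close> freely and fill \<open>Q\<close> from \<open>W - P\<close>
  before touching \<open>P\<close>. Truncated subtraction covers the case in which no overlap is
  forced.\<close>

lemma obtain_subsets_small_overlap:
  assumes "finite W" "p \<le> card W" "q \<le> card W"
  obtains P Q where "P \<subseteq> W" "card P = p" "Q \<subseteq> W" "card Q = q" "card (P \<inter> Q) = p + q - card W"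
proof -
  obtain P where P: "P \<subseteq> W" "card P = p"
    using assms obtain_subset_with_card_n by metis
  have fP: "finite P" using P assms finite_subset by blast
  have cWP: "card (W - P) = card W - p"
    using P fP by (simp add: card_Diff_subset)
  show ?thesis
  proof (cases "q \<le> card W - p")
    case True
    then obtain Q where Q: "Q \<subseteq> W - P" "card Q = q"
      using cWP obtain_subset_with_card_n by metis
    then have "P \<inter> Q = {}" by blast
    then have "card (P \<inter> Q) = p + q - card W" using True assms by simp
    then show ?thesis using that P Q by blast
  next
    case False
    then have "p + q - card W \<le> card P" using P assms by simp
    then obtain Z where Z: "Z \<subseteq> P" "card Z = p + q - card W"
      using obtain_subset_with_card_n by metis
    have "card ((W - P) \<union> Z) = card (W - P) + card Z"
      using Z fP assms by (intro card_Un_disjoint) (auto dest: finite_subset)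
    then have "card ((W - P) \<union> Z) = q" using cWP Z False assms by simp
    moreover have "P \<inter> ((W - P) \<union> Z) = Z" using Z by blast
    ultimately show ?thesis using that[of P "(W - P) \<union> Z"] P Z by auto
  qed
qed

text \<open>A two-set form of Hall's condition. \<open>P\<close> exhausts \<open>X - Y\<close>
  before it takes anything from \<open>X \<inter> Y\<close>, so that as much of \<open>Y\<close> as
  possible is left for \<open>Q\<close>.\<close>

lemma obtain_disjoint_subsets:
  assumes "finite X" "finite Y" "p \<le> card X" "q \<le> card Y" "p + q \<le> card (X \<union> Y)"
  obtains P Q where "P \<subseteq> X" "card P = p" "Q \<subseteq> Y" "card Q = q" "P \<inter> Q = {}"
proof (cases "p \<le> card (X - Y)")
  case True
  then obtain P where "P \<subseteq> X - Y" "card P = p" using obtain_subset_with_card_n by metis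
  moreover obtain Q where "Q \<subseteq> Y" "card Q = q" using assms obtain_subset_with_card_n by metis
  ultimately show ?thesis using that[of P Q] by blast
next
  case False
  have X: "card X = card (X - Y) + card (X \<inter> Y)"
    using assms card_Un_disjoint[of "X - Y" "X \<inter> Y"] by (auto simp: Un_Diff_Int)
  have XY: "card (X \<union> Y) = card (X - Y) + card Y"
    using assms card_Un_disjoint[of "X - Y" Y] by (simp add: Un_Diff_cancel2 Int_commute)
  have leZ: "p - card (X - Y) \<le> card (X \<inter> Y)" using X assms by simp
  obtain Z where Z: "Z \<subseteq> X \<inter> Y" "card Z = p - card (X - Y)"
    using leZ obtain_subset_with_card_n by metis
  have fZ: "finite Z" using Z assms finite_subset by blast
  have "card (Y - Z) = card Y - card Z" using Z fZ by (intro card_Diff_subset) auto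
  then have "q \<le> card (Y - Z)" using Z XY False assms by simp
  then obtain Q where Q: "Q \<subseteq> Y - Z" "card Q = q" using obtain_subset_with_card_n by metis
  have "card ((X - Y) \<union> Z) = card (X - Y) + card Z"
    using Z fZ assms by (intro card_Un_disjoint) auto
  then have "card ((X - Y) \<union> Z) = p" using Z False by simp
  then show ?thesis using that[of "(X - Y) \<union> Z" Q] Z Q by blast
qed

text \<open>A colour can occur on at most two of five cyclically arranged cliques, whence the factor
  2 in the last bound. After \<open>D1\<close>, the sets \<open>D2\<close> and \<open>D5\<close> are
  chosen to overlap as little as possible, because only their common colours are lost to both
  \<open>D3\<close> and \<open>D4\<close>.\<close>

lemma obtain_C5_palettes:
  fixes a1 a2 a3 a4 a5 :: nat
  assumes "finite U"
    and "a1 + a2 \<le> card U" "a2 + a3 \<le> card U" "a3 + a4 \<le> card U" "a4 + a5 \<le> card U" "a5 + a1 \<le> card U"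
    and "a1 + a2 + a3 + a4 + a5 \<le> 2 * card U"
  obtains D1 D2 D3 D4 D5
  where "D1 \<subseteq> U" "D2 \<subseteq> U" "D3 \<subseteq> U" "D4 \<subseteq> U" "D5 \<subseteq> U"
    and "card D1 = a1" "card D2 = a2" "card D3 = a3" "card D4 = a4" "card D5 = a5"
    and "D1 \<inter> D2 = {}" "D2 \<inter> D3 = {}" "D3 \<inter> D4 = {}" "D4 \<inter> D5 = {}" "D5 \<inter> D1 = {}"
proof -
  obtain D1 where D1: "D1 \<subseteq> U" "card D1 = a1"
    using assms obtain_subset_with_card_n[of a1 U] by auto
  have c1: "card (U - D1) = card U - a1"
    using D1 assms by (simp add: card_Diff_subset finite_subset)
  have le25: "a2 \<le> card (U - D1)" "a5 \<le> card (U - D1)" using c1 assms by simp_all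
  obtain D2 D5 where D25: "D2 \<subseteq> U - D1" "card D2 = a2" "D5 \<subseteq> U - D1" "card D5 = a5"
      "card (D2 \<inter> D5) = a2 + a5 - (card U - a1)"
    using obtain_subsets_small_overlap[of "U - D1" a2 a5, OF _ le25] assms(1) unfolding c1 by blast
  have sub: "D2 \<subseteq> U" "D5 \<subseteq> U" "D2 \<inter> D5 \<subseteq> U" using D25 by auto
  have compl: "card (U - D) = card U - card D" if "D \<subseteq> U" for D
    using that assms by (simp add: card_Diff_subset finite_subset)
  \<comment> \<open>If \<open>D2 \<inter> D5\<close> is empty, the bound on \<open>a3 + a4\<close>
    suffices. Otherwise it has \<open>a1 + a2 + a5 - card U\<close> elements, and the bound on the
    sum of all five sizes is exactly what is needed.\<close>
  have "(U - D2) \<union> (U - D5) = U - D2 \<inter> D5" by blast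
  then have "a3 + a4 \<le> card ((U - D2) \<union> (U - D5))"
    using compl[OF sub(3)] D25(5) assms by simp
  moreover have "a3 \<le> card (U - D2)" "a4 \<le> card (U - D5)"
    using compl[OF sub(1)] compl[OF sub(2)] D25 assms by simp_all
  ultimately obtain D3 D4 where
    "D3 \<subseteq> U - D2" "card D3 = a3" "D4 \<subseteq> U - D5" "card D4 = a4" "D3 \<inter> D4 = {}"
    using obtain_disjoint_subsets[of "U - D2" "U - D5" a3 a4] assms(1) by blast
  then show ?thesis using D1 D25 that[of D1 D2 D3 D4 D5] by blast
qed

text \<open>The colours in \<open>R\<close> are barred from positions 1, 3 and 4 only. Positions 2
  and 5 are not consecutive on the cycle, so both may draw on the same colours of \<open>R\<close>;
  just their excess over \<open>card R\<close> has to compete for \<open>K - R\<close>.\<close>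

lemma obtain_C5_palettes_reusing:
  fixes a1 a2 a3 a4 a5 :: nat
  assumes "finite K" "R \<subseteq> K"
    and "a1 + card R \<le> card K" "a3 + a4 + card R \<le> card K"
    and "a1 + a2 \<le> card K" "a2 + a3 \<le> card K" "a4 + a5 \<le> card K" "a5 + a1 \<le> card K"
    and "a1 + a2 + a3 + a4 + a5 \<le> 2 * card K"
  obtains D1 D2 D3 D4 D5
  where "D1 \<subseteq> K - R" "D2 \<subseteq> K" "D3 \<subseteq> K - R" "D4 \<subseteq> K - R" "D5 \<subseteq> K"
    and "card D1 = a1" "card D2 = a2" "card D3 = a3" "card D4 = a4" "card D5 = a5"
    and "D1 \<inter> D2 = {}" "D2 \<inter> D3 = {}" "D3 \<inter> D4 = {}" "D4 \<inter> D5 = {}" "D5 \<inter> D1 = {}"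
proof -
  define r where "r = card R"
  have fR: "finite R" using assms finite_subset by blast
  have cU: "card (K - R) = card K - r"
    unfolding r_def using assms fR by (simp add: card_Diff_subset)
  obtain C1 C2 C3 C4 C5 where
    C: "C1 \<subseteq> K - R" "C2 \<subseteq> K - R" "C3 \<subseteq> K - R" "C4 \<subseteq> K - R" "C5 \<subseteq> K - R"
      "card C1 = a1" "card C2 = a2 - r" "card C3 = a3" "card C4 = a4" "card C5 = a5 - r"
      "C1 \<inter> C2 = {}" "C2 \<inter> C3 = {}" "C3 \<inter> C4 = {}" "C4 \<inter> C5 = {}" "C5 \<inter> C1 = {}"
  proof (rule obtain_C5_palettes[of "K - R" a1 "a2 - r" a3 a4 "a5 - r"])
    \<comment> \<open>If \<open>a2\<close> and \<open>a5\<close> are both at least \<open>r\<close>,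
      this is the bound on the total. If only \<open>a5\<close> is smaller, add
      \<open>a1 + a2 \<le> card K\<close> and \<open>a3 + a4 + r \<le> card K\<close>; the case of
      \<open>a2\<close> is symmetric. If both are smaller, use \<open>a1 + r \<le> card K\<close>
      instead.\<close>
    show "a1 + (a2 - r) + a3 + a4 + (a5 - r) \<le> 2 * card (K - R)"
      unfolding cU using assms unfolding r_def[symmetric] by arith
  qed (use assms in \<open>auto simp: cU r_def\<close>)
  \<comment> \<open>With truncated subtraction, \<open>a - r\<close> and \<open>min a r\<close>
    always add up to \<open>a\<close>.\<close>
  have extend: "\<exists>R'\<subseteq>R. card (C \<union> R') = a" if "C \<subseteq> K - R" "card C = a - r" for C a
  proof -
    obtain R' where R': "R' \<subseteq> R" "card R' = min a r"
      unfolding r_def using obtain_subset_with_card_n[of "min a (card R)" R] by auto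
    have "card (C \<union> R') = card C + card R'"
      using that R' fR assms by (intro card_Un_disjoint) (auto dest: finite_subset)
    then show ?thesis using that R' by auto
  qed
  obtain R2 where R2: "R2 \<subseteq> R" "card (C2 \<union> R2) = a2" using extend C(2,7) by metis
  obtain R5 where R5: "R5 \<subseteq> R" "card (C5 \<union> R5) = a5" using extend C(5,10) by metis
  have sub: "C2 \<union> R2 \<subseteq> K" "C5 \<union> R5 \<subseteq> K" using C(2,5) R2(1) R5(1) assms(2) by auto
  have dis: "C1 \<inter> (C2 \<union> R2) = {}" "(C2 \<union> R2) \<inter> C3 = {}" "C4 \<inter> (C5 \<union> R5) = {}"
    "(C5 \<union> R5) \<inter> C1 = {}"
    using C(1,3,4,11,12,14,15) R2(1) R5(1) by auto
  show ?thesis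
    by (rule that[OF C(1) sub(1) C(3,4) sub(2) C(6) R2(2) C(8,9) R5(2) dis(1,2) C(13) dis(3,4)])
qed

section \<open>Clique number and colourings of induced subgraphs\<close>

lemma finite_clique_cards:
  assumes "finite (verts G)"
  shows "finite {card X | X. clique G X}"
proof -
  have "{card X | X. clique G X} \<subseteq> card ` Pow (verts G)"
    unfolding clique_def by blast
  then show ?thesis using assms finite_subset by blast
qed

lemma card_le_clique_number:
  assumes "finite (verts G)" "clique G X"
  shows "card X \<le> clique_number G"
  unfolding clique_number_def using assms finite_clique_cards by (intro Max_ge) auto

lemma clique_number_induced_le:
  assumes "finite (verts G)" "induced_subgraph H G"
  shows "clique_number H \<le> clique_number G"
proof -
  have sub: "subgraph H G" using assms by blast
  have "clique G X" if "clique H X" for X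
    using that sub pre_digraph.adj_mono[OF _ sub] unfolding clique_def by blast
  then have "{card X | X. clique H X} \<subseteq> {card X | X. clique G X}" by blast
  \<comment> \<open>The empty clique keeps the smaller set of cardinalities non-empty, as
    monotonicity of \<open>Max\<close> demands.\<close>
  moreover have "clique H {}" by (simp add: clique_def)
  ultimately show ?thesis
    unfolding clique_number_def using assms finite_clique_cards
    by (intro Max_mono) auto
qed

text \<open>The \<open>LEAST\<close> in the definition is attained once some colouring exists;
  without loops, an injective numbering of the vertices is one.\<close>

lemma proper_colouring_chromatic_number:
  assumes "finite (verts G)" "\<And>v. \<not> v \<rightarrow>\<^bsub>G\<^esub> v"
  obtains c where "proper_colouring G (chromatic_number G) c"
proof -
  obtain f where f: "bij_betw f (verts G) {0..<card (verts G)}"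
    using ex_bij_betw_finite_nat assms(1) by blast
  have "proper_colouring G (card (verts G)) f"
    unfolding proper_colouring_def
    using f assms(2) by (fastforce simp: bij_betw_def inj_on_def)
  then have "\<exists>c. proper_colouring G (chromatic_number G) c"
    unfolding chromatic_number_def using LeastI_ex[of "\<lambda>k. \<exists>c. proper_colouring G k c"] by blast
  then show ?thesis using that by blast
qed

lemma proper_colouring_mono:
  "proper_colouring G j c \<Longrightarrow> j \<le> k \<Longrightarrow> proper_colouring G k c"
  unfolding proper_colouring_def by (auto intro: less_le_trans)

lemma chromatic_number_le:
  "proper_colouring G k c \<Longrightarrow> chromatic_number G \<le> k"
  unfolding chromatic_number_def by (blast intro: Least_le)

lemma clique_Un:
  assumes "graph G" "clique G X" "clique G Y" "complete_to G X Y"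
  shows "clique G (X \<union> Y)"
proof -
  interpret graph G by fact
  have "y \<rightarrow>\<^bsub>G\<^esub> x" if "x \<in> X" "y \<in> Y" for x y
    using that assms(4) arcs_ends_symmetric[OF sym_arcs] unfolding complete_to_def by simp
  then show ?thesis
    using assms(2-) unfolding clique_def complete_to_def by auto
qed

text \<open>The clique \<open>M\<close> takes \<open>card M\<close> distinct colours, none of which
  can recur on \<open>B\<close>. The set \<open>C\<close> leaves room for further vertices coloured
  at the same time.\<close>

lemma colouring_few_colours:
  assumes "graph G" "clique G M" "complete_to G M B" "proper_colouring (G \<restriction> (M \<union> B \<union> C)) k c"
  shows "card M + card (c ` B) \<le> k"
proof -
  interpret graph G by fact
  have adj: "u \<rightarrow>\<^bsub>G \<restriction> S\<^esub> v" if "u \<rightarrow>\<^bsub>G\<^esub> v" "u \<in> S" "v \<in> S" for u v S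
    using that by (auto simp: arcs_ends_conv arc_to_ends_def)
  have ne: "c u \<noteq> c v" if "u \<rightarrow>\<^bsub>G\<^esub> v" "u \<in> M \<union> B" "v \<in> M \<union> B" for u v
    using assms(4) adj[of u v "M \<union> B \<union> C"] that unfolding proper_colouring_def by auto
  have inj: "inj_on c M"
    using ne assms(2) unfolding clique_def inj_on_def by blast
  have sub: "c ` M \<union> c ` B \<subseteq> {..<k}"
    using assms(4) unfolding proper_colouring_def by auto
  then have fin: "finite (c ` M)" "finite (c ` B)" by (auto dest: finite_subset)
  have "c ` M \<inter> c ` B = {}"
    using ne assms(3) unfolding complete_to_def by fastforce
  then have "card (c ` M \<union> c ` B) = card M + card (c ` B)"
    using fin inj by (simp add: card_Un_disjoint card_image)
  then show ?thesis using card_mono[OF _ sub] by simp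
qed

text \<open>The clique number is monotone under induced subgraphs, so the number of colours can be
  stated in terms of \<open>G\<close> rather than the subgraph.\<close>

lemma proper_induced_colouring:
  assumes "graph G" "S \<subset> verts G"
    and "\<And>H. induced_subgraph H G \<Longrightarrow> H \<noteq> G \<Longrightarrow>
           int (chromatic_number H) \<le> \<lceil>5 / 4 * real (clique_number H)\<rceil>"
  obtains c where "proper_colouring (G \<restriction> S) (nat \<lceil>5 / 4 * real (clique_number G)\<rceil>) c"
proof -
  interpret graph G by fact
  have ind: "induced_subgraph (G \<restriction> S) G" using assms(2) by (simp add: induced_induce psubset_imp_subset)
  have "finite (verts (G \<restriction> S))" using assms(2) finite_verts by (auto dest: finite_subset)
  moreover have "\<not> v \<rightarrow>\<^bsub>G \<restriction> S\<^esub> v" for v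
    using adj_not_same dominates_induce_subgraphD by metis
  ultimately obtain c where c: "proper_colouring (G \<restriction> S) (chromatic_number (G \<restriction> S)) c"
    using proper_colouring_chromatic_number by blast
  have "G \<restriction> S \<noteq> G" using assms(2) by (metis induce_subgraph_verts less_irrefl)
  then have "int (chromatic_number (G \<restriction> S)) \<le> \<lceil>5 / 4 * real (clique_number (G \<restriction> S))\<rceil>"
    using assms(3) ind by blast
  also have "\<dots> \<le> \<lceil>5 / 4 * real (clique_number G)\<rceil>"
    using clique_number_induced_le[OF finite_verts ind] by (intro ceiling_mono) simp
  finally have "chromatic_number (G \<restriction> S) \<le> nat \<lceil>5 / 4 * real (clique_number G)\<rceil>" by linarith
  then show ?thesis using that proper_colouring_mono[OF c] by blast
qed

section \<open>Extending a colouring of \<open>A 6 \<union> A 7\<close> to the blown-up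
  5-cycle\<close>

theorem theorem10:
  fixes G :: "('a, 'b) pre_digraph" and A :: "nat \<Rightarrow> 'a set"
  assumes "graph G"
    and "Digraph_Component.connected G"
    and "\<not> contains_induced G (with_proj (path_graph 5))"
    and "\<not> contains_induced G (with_proj gem)"
    and "verts G = (\<Union>i\<in>{1..7}. A i)"
    and "disjoint_family_on A {1..7}"
    and "\<And>i. i \<in> {1..7} \<Longrightarrow> A i \<noteq> {}"
    and "\<And>i. i \<in> {1..5} \<Longrightarrow> clique G (A i)"
    and "\<not> contains_induced (G \<restriction> A 6) (with_proj (path_graph 4))"
    and "complete_to G (A 1) (A 2 \<union> A 5 \<union> A 6)"
    and "anticomplete_to G (A 1) (A 3 \<union> A 4 \<union> A 7)"
    and "complete_to G (A 3) (A 2 \<union> A 4 \<union> A 6)"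
    and "anticomplete_to G (A 3) (A 5 \<union> A 7)"
    and "complete_to G (A 4) (A 5 \<union> A 6)"
    and "anticomplete_to G (A 4) (A 2 \<union> A 7)"
    and "anticomplete_to G (A 2) (A 5 \<union> A 6 \<union> A 7)"
    and "anticomplete_to G (A 5) (A 6 \<union> A 7)"
    and "\<And>C. component (G \<restriction> A 7) C \<Longrightarrow> clique G (verts C) \<and> homogeneous G (verts C)"
    and "\<And>G'. induced_subgraph G' G \<Longrightarrow> G' \<noteq> G \<Longrightarrow>
           int (chromatic_number G') \<le> \<lceil>5 / 4 * real (clique_number G')\<rceil>"
  shows "int (chromatic_number G) \<le> \<lceil>5 / 4 * real (clique_number G)\<rceil>"
proof -
  interpret graph G by fact
  define w where "w = clique_number G"
  define k where "k = nat \<lceil>5 / 4 * real w\<rceil>"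
  \<comment> \<open>This is where the factor 5/4 enters: five consecutive pairs of cliques, each of
    total size at most \<open>w\<close>, count every clique twice, so the five sizes sum to at most
    \<open>5 * w / 2 \<le> 2 * k\<close>.\<close>
  have k_ge: "5 * w \<le> 4 * k" unfolding k_def by linarith
  have w_le_k: "w \<le> k" using k_ge by simp
  have verts7: "verts G = A 1 \<union> A 2 \<union> A 3 \<union> A 4 \<union> A 5 \<union> A 6 \<union> A 7"
  proof -
    have "{1..7} = {1,2,3,4,5,6,7::nat}" by auto
    then show ?thesis using assms(5) by auto
  qed
  have notin: "v \<notin> A j" if "v \<in> A i" "i \<in> {1..7}" "j \<in> {1..7}" "i \<noteq> j" for v i j
    using assms(6) that unfolding disjoint_family_on_def by blast
  have cl: "clique G (A 1)" "clique G (A 2)" "clique G (A 3)" "clique G (A 4)" "clique G (A 5)"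
    using assms(8) by auto
  have com: "complete_to G (A 1) (A 2)" "complete_to G (A 1) (A 5)" "complete_to G (A 3) (A 2)"
    "complete_to G (A 3) (A 4)" "complete_to G (A 4) (A 5)" "complete_to G (A 1) (A 6)"
    "complete_to G (A 3 \<union> A 4) (A 6)"
    using assms(10,12,14) unfolding complete_to_def by auto
  have pair: "card (A i) + card (A j) \<le> w"
    if "clique G (A i)" "clique G (A j)" "complete_to G (A i) (A j)" for i j
  proof -
    have fin: "finite (A i)" "finite (A j)"
      using that finite_verts unfolding clique_def by (auto dest: finite_subset)
    have "A i \<inter> A j = {}"
      using that(3) adj_not_same unfolding complete_to_def by blast
    then show ?thesis
      using card_le_clique_number[OF finite_verts clique_Un[OF assms(1) that]] fin
      unfolding w_def by (simp add: card_Un_disjoint)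
  qed
  have pairs: "card (A 1) + card (A 2) \<le> w" "card (A 1) + card (A 5) \<le> w" "card (A 3) + card (A 2) \<le> w"
    "card (A 3) + card (A 4) \<le> w" "card (A 4) + card (A 5) \<le> w"
    using pair cl com by blast+
  have c34: "card (A 3 \<union> A 4) = card (A 3) + card (A 4)"
    using cl(3,4) finite_verts notin[of _ 3 4] unfolding clique_def
    by (intro card_Un_disjoint) (auto dest: finite_subset)
  obtain c where c: "\<And>u v. u \<in> A 6 \<union> A 7 \<Longrightarrow> v \<in> A 6 \<union> A 7 \<Longrightarrow> u \<rightarrow>\<^bsub>G\<^esub> v \<Longrightarrow> c u \<noteq> c v"
    "c ` (A 6 \<union> A 7) \<subseteq> {..<k}"
    "card (A 1) + card (c ` A 6) \<le> k" "card (A 3) + card (A 4) + card (c ` A 6) \<le> k"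
  proof -
    define M where "M = (if card (A 3) + card (A 4) \<le> card (A 1) then A 1 else A 3 \<union> A 4)"
    have M: "clique G M" "complete_to G M (A 6)"
      "card (A 1) \<le> card M" "card (A 3) + card (A 4) \<le> card M"
      using cl com clique_Un[OF assms(1) cl(3,4) com(4)] c34 unfolding M_def by auto
    define S where "S = M \<union> A 6 \<union> A 7"
    \<comment> \<open>Missing the non-empty set \<open>A 2\<close> makes the induced subgraph on
      \<open>S\<close> proper.\<close>
    have "A 2 \<inter> S = {}"
      using notin[of _ 2] unfolding S_def M_def by auto
    moreover have "S \<subseteq> verts G" unfolding S_def M_def verts7 by auto
    ultimately have "S \<subset> verts G" using verts7 assms(7)[of 2] by auto
    then obtain c where c: "proper_colouring (G \<restriction> S) k c"
      using proper_induced_colouring[OF assms(1) _ assms(19)] unfolding k_def w_def by metis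
    have few: "card M + card (c ` A 6) \<le> k"
      using colouring_few_colours[OF assms(1) M(1,2)] c unfolding S_def by blast
    have "c u \<noteq> c v" if "u \<in> A 6 \<union> A 7" "v \<in> A 6 \<union> A 7" "u \<rightarrow>\<^bsub>G\<^esub> v" for u v
    proof -
      have "u \<rightarrow>\<^bsub>G \<restriction> S\<^esub> v" using that unfolding S_def by (auto simp: arcs_ends_conv arc_to_ends_def)
      then show ?thesis using c that unfolding proper_colouring_def S_def by auto
    qed
    moreover have "c ` (A 6 \<union> A 7) \<subseteq> {..<k}"
      using c unfolding proper_colouring_def S_def by auto
    ultimately show ?thesis using that[of c] few M(3,4) by simp
  qed
  \<comment> \<open>Among \<open>A 1\<close> to \<open>A 5\<close>, only \<open>A 1\<close>,
    \<open>A 3\<close> and \<open>A 4\<close> have edges to \<open>A 6\<close>, and none has edges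
    to \<open>A 7\<close>. Hence the colours on \<open>A 7\<close> need no protection.\<close>
  define R where "R = c ` A 6"
  have R: "R \<subseteq> {..<k}" using c(2) unfolding R_def by auto
  obtain D1 D2 D3 D4 D5 where
    sub: "D1 \<subseteq> {..<k} - R" "D2 \<subseteq> {..<k}" "D3 \<subseteq> {..<k} - R" "D4 \<subseteq> {..<k} - R" "D5 \<subseteq> {..<k}" and
    cards: "card D1 = card (A 1)" "card D2 = card (A 2)" "card D3 = card (A 3)"
      "card D4 = card (A 4)" "card D5 = card (A 5)" and
    D: "D1 \<inter> D2 = {}" "D2 \<inter> D3 = {}" "D3 \<inter> D4 = {}" "D4 \<inter> D5 = {}" "D5 \<inter> D1 = {}"
    by (rule obtain_C5_palettes_reusing[of "{..<k}" R "card (A 1)" "card (A 3)" "card (A 4)"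
          "card (A 2)" "card (A 5)"])
      (use R c(3,4) pairs w_le_k k_ge in \<open>auto simp: R_def\<close>)
  have "\<exists>f. bij_betw f (A i) D'" if "clique G (A i)" "card D' = card (A i)" "D' \<subseteq> {..<k}" for i D'
    using that finite_verts unfolding clique_def
    by (intro finite_same_card_bij) (auto dest: finite_subset)
  then obtain f1 f2 f3 f4 f5 where
    f: "bij_betw f1 (A 1) D1" "bij_betw f2 (A 2) D2" "bij_betw f3 (A 3) D3"
      "bij_betw f4 (A 4) D4" "bij_betw f5 (A 5) D5"
    using cl cards sub by (metis Diff_subset subset_trans)
  define g where "g v = (if v \<in> A 1 then f1 v else if v \<in> A 2 then f2 v else if v \<in> A 3 then f3 v
     else if v \<in> A 4 then f4 v else if v \<in> A 5 then f5 v else c v)" for v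
  have g_eq: "v \<in> A 1 \<Longrightarrow> g v = f1 v" "v \<in> A 2 \<Longrightarrow> g v = f2 v" "v \<in> A 3 \<Longrightarrow> g v = f3 v"
    "v \<in> A 4 \<Longrightarrow> g v = f4 v" "v \<in> A 5 \<Longrightarrow> g v = f5 v" "v \<in> A 6 \<union> A 7 \<Longrightarrow> g v = c v" for v
    using notin[of v] unfolding g_def by auto
  have gA: "g ` A 1 \<subseteq> D1" "g ` A 2 \<subseteq> D2" "g ` A 3 \<subseteq> D3" "g ` A 4 \<subseteq> D4" "g ` A 5 \<subseteq> D5" "g ` A 6 \<subseteq> R"
    using g_eq f unfolding R_def by (auto dest: bij_betwE)
  \<comment> \<open>These are the pairs of distinct classes that may be joined by edges, apart from
    \<open>A 6\<close> and \<open>A 7\<close>. Pairs on the cycle have disjoint palettes; those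
    involving \<open>A 6\<close> are separated because \<open>D1\<close>, \<open>D3\<close> and
    \<open>D4\<close> avoid \<open>R\<close>.\<close>
  have apart: "g ` A 1 \<inter> g ` A 2 = {}" "g ` A 1 \<inter> g ` A 5 = {}" "g ` A 1 \<inter> g ` A 6 = {}"
    "g ` A 3 \<inter> g ` A 2 = {}" "g ` A 3 \<inter> g ` A 4 = {}" "g ` A 3 \<inter> g ` A 6 = {}"
    "g ` A 4 \<inter> g ` A 5 = {}" "g ` A 4 \<inter> g ` A 6 = {}"
    subgoal using gA(1,2) D(1) by blast
    subgoal using gA(1,5) D(5) by blast
    subgoal using gA(1,6) sub(1) by blast
    subgoal using gA(2,3) D(2) by blast
    subgoal using gA(3,4) D(3) by blast
    subgoal using gA(3,6) sub(3) by blast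
    subgoal using gA(4,5) D(4) by blast
    subgoal using gA(4,6) sub(4) by blast
    done
  have inj: "inj_on g (A 1)" "inj_on g (A 2)" "inj_on g (A 3)" "inj_on g (A 4)" "inj_on g (A 5)"
    using f g_eq by (auto simp: bij_betw_def inj_on_def)
  have g67: "g u \<noteq> g v" if "u \<in> A 6 \<union> A 7" "v \<in> A 6 \<union> A 7" "u \<rightarrow>\<^bsub>G\<^esub> v" for u v
    using c(1)[OF that] g_eq(6) that by simp
  have "g ` (A 6 \<union> A 7) \<subseteq> {..<k}" using c(2) g_eq(6) by auto
  moreover have "g ` A 1 \<subseteq> {..<k}" "g ` A 2 \<subseteq> {..<k}" "g ` A 3 \<subseteq> {..<k}"
    "g ` A 4 \<subseteq> {..<k}" "g ` A 5 \<subseteq> {..<k}"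
    using gA(1-5) sub by auto
  ultimately have "g ` verts G \<subseteq> {..<k}" unfolding verts7 image_Un by (simp only: Un_subset_iff)
  moreover have "g u \<noteq> g v" if "u \<in> verts G" "v \<in> verts G" and uv: "u \<rightarrow>\<^bsub>G\<^esub> v" for u v
  proof
    assume eq: "g u = g v"
    have vu: "v \<rightarrow>\<^bsub>G\<^esub> u" and "u \<noteq> v" using arcs_ends_symmetric[OF sym_arcs uv] uv adj_not_same by blast+
    then have same: "\<not> (u \<in> A i \<and> v \<in> A i)" if "inj_on g (A i)" for i
      using that eq by (auto dest: inj_onD)
    have nonadj: "\<not> (x \<in> A 1 \<and> y \<in> A 3 \<union> A 4 \<union> A 7)" "\<not> (x \<in> A 3 \<and> y \<in> A 5 \<union> A 7)"
      "\<not> (x \<in> A 4 \<and> y \<in> A 2 \<union> A 7)" "\<not> (x \<in> A 2 \<and> y \<in> A 5 \<union> A 6 \<union> A 7)"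
      "\<not> (x \<in> A 5 \<and> y \<in> A 6 \<union> A 7)" if "x \<rightarrow>\<^bsub>G\<^esub> y" for x y
      using that assms(11,13,15-17) unfolding anticomplete_to_def by blast+
    have sep: "\<not> (x \<in> X \<and> y \<in> Y)" if "g ` X \<inter> g ` Y = {}" "g x = g y" for X Y x y
      using that by (metis IntI empty_iff imageI)
    have differ: "\<not> (x \<in> A 1 \<and> y \<in> A 2 \<union> A 5 \<union> A 6)" "\<not> (x \<in> A 3 \<and> y \<in> A 2 \<union> A 4 \<union> A 6)"
      "\<not> (x \<in> A 4 \<and> y \<in> A 5 \<union> A 6)" if "g x = g y" for x y
      using apart[THEN sep, OF that] by blast+
    have "\<not> (u \<in> A 6 \<union> A 7 \<and> v \<in> A 6 \<union> A 7)" using g67[OF _ _ uv] eq by blast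
    \<comment> \<open>Every pair of classes is ruled out: equal cliques by injectivity, anticomplete
      pairs by the edge, complete pairs by their colours, and pairs within
      \<open>A 6 \<union> A 7\<close> by the retained colouring. Both orientations are listed since
      each fact names its classes in one order.\<close>
    note excluded = this inj[THEN same] nonadj[OF uv] nonadj[OF vu] differ[OF eq] differ[OF eq[symmetric]]
    from that(1) show False
      unfolding verts7 by (elim UnE) (use that(2)[unfolded verts7] excluded in \<open>simp; fail\<close>)+
  qed
  ultimately have "proper_colouring G k g" unfolding proper_colouring_def by blast
  then have "chromatic_number G \<le> k" by (rule chromatic_number_le)
  then show ?thesis unfolding k_def w_def by linarith
qed

end
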